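(* Let $n\ge 4$ and $k>0$ be integers. Let $\tilde R$ be a quiver on the vertex set $[1,n-1]$ such that $b_{ij}(\tilde R)\ge 2$ whenever $i<j$. Define a quiver $Q$ on the vertex set $[1,n]$ by requiring that its full subquiver on $[1,n-1]$ equals the quiver obtained from $\tilde R$ by mutating successively at $2,1,2,1,\dots,2,1$ ($2k$ mutations, starting with $2$), and choosing the values $b_{in}(Q)\ge 2$ ($1\le i\le n-1$) arbitrarily (so $n$ is a sink of $Q$). Then $Q$ lies on a mutation cycle of length $n+4k$: applying to $Q$ the mutations at the vertices $$n,\ 1,2,1,2,\dots,1,2\ (2k\text{ mutations}),\ n-1,\ n-2,\ \dots,\ 2,\ 1,\ 2,1,2,1,\dots,2,1\ (2k\text{ mutations})$$ in this order returns $Q$.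
   Context: A quiver on the vertex set $[1,n]$ is a finite directed multigraph with no loops and no oriented 2-cycles; quivers are labeled. A quiver $Q$ is encoded by the skew-symmetric integer matrix $B(Q)=(b_{ij})$, where $b_{ij}>0$ means there are $b_{ij}$ arrows from $i$ to $j$. The full subquiver on a vertex subset $S$ is the induced subgraph on $S$. Mutation at a vertex $k$ produces the quiver $\mu[k](Q)$ with matrix $b'_{ij}=-b_{ij}$ if $k\in\{i,j\}$ and $b'_{ij}=b_{ij}+\tfrac12(|b_{ik}|b_{kj}+b_{ik}|b_{kj}|)$ otherwise. A vertex $n$ is a sink if $b_{in}\ge 0$ for all $i$. A mutation cycle of length $N$ based at $Q$ is a sequence $i_1,\dots,i_N$ of vertices with consecutive entries distinct (cyclically, including $i_N\ne i_1$), no mutation applied at an isolated vertex, such that mutating $Q$ successively at $i_1,\dots,i_N$ returns $Q$. *)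

theory Defs
  imports Main
begin

(* A quiver (finite directed multigraph without loops and oriented 2-cycles, labeled
   vertices) is represented by its skew-symmetric integer matrix B: there are B i j
   arrows from i to j if B i j > 0.  Entries outside the vertex set V are required to
   be 0, so that equality of functions is equality of labeled quivers on V. *)

type_synonym quiver = "nat \<Rightarrow> nat \<Rightarrow> int"

definition quiver_on :: "nat set \<Rightarrow> quiver \<Rightarrow> bool" where
  "quiver_on V B \<longleftrightarrow> finite V \<and> (\<forall>i j. B i j = - B j i)
     \<and> (\<forall>i j. i \<notin> V \<or> j \<notin> V \<longrightarrow> B i j = 0)"

definition full_subquiver :: "nat set \<Rightarrow> quiver \<Rightarrow> quiver" where
  "full_subquiver S B = (\<lambda>i j. if i \<in> S \<and> j \<in> S then B i j else 0)"

(* The division by 2 is exact: the numerator is 0 or plus/minus 2 * B i k * B k j. *)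
definition mutate :: "nat \<Rightarrow> quiver \<Rightarrow> quiver" where
  "mutate k B = (\<lambda>i j. if k = i \<or> k = j then - B i j
     else B i j + (\<bar>B i k\<bar> * B k j + B i k * \<bar>B k j\<bar>) div 2)"

(* The head of the list is the first vertex to be mutated at. *)
definition mutate_seq :: "nat list \<Rightarrow> quiver \<Rightarrow> quiver" where
  "mutate_seq vs B = fold mutate vs B"

definition is_sink :: "nat set \<Rightarrow> quiver \<Rightarrow> nat \<Rightarrow> bool" where
  "is_sink V B v \<longleftrightarrow> v \<in> V \<and> (\<forall>i\<in>V. B i v \<ge> 0)"

definition isolated :: "nat set \<Rightarrow> quiver \<Rightarrow> nat \<Rightarrow> bool" where
  "isolated V B v \<longleftrightarrow> (\<forall>j\<in>V. B v j = 0)"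

(* The index Suc t mod N makes the distinctness condition cyclic: for t = N - 1 it
   compares the last vertex with the first.  Isolation is tested in the quiver
   reached just before the mutation in question. *)
definition mutation_cycle :: "nat set \<Rightarrow> quiver \<Rightarrow> nat \<Rightarrow> nat list \<Rightarrow> bool" where
  "mutation_cycle V B N vs \<longleftrightarrow>
     vs \<noteq> [] \<and> length vs = N \<and> set vs \<subseteq> V
     \<and> (\<forall>t<N. vs ! t \<noteq> vs ! (Suc t mod N))
     \<and> (\<forall>t<N. \<not> isolated V (mutate_seq (take t vs) B) (vs ! t))
     \<and> mutate_seq vs B = B"

end

(* Mutating at the sink n makes it a source without touching [1,n-1].  The mutations
   1,2,...,1,2 undo those defining Q on [1,n-1], leaving the acyclic quiver R there; the number
   of arrows between n and each j in [3,n-1] does not change, and the entries at (1,n), (2,n)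
   follow a linear recurrence that turns the triangle 1,2,n into an oriented cycle.
   The vertices n-1,...,1 are then successive sinks of the part on [1,n-1], so R is restored, while
   column n is mutated by a run of sinks n-1,...,3 followed by one backward step 2,1 of the
   recurrence.  This last step increases the entries (j,n), j >= 3, by some amount.  The final
   mutations 2,1,...,2,1 run the recurrence backwards to its starting values; only their last pair
   affects the entries (j,n), and it decreases them by the same amount, because a bilinear
   pairing of the entries (1,j), (2,j) with the recurrence values is conserved. *)

theory Submission
  imports Defs
begin

text \<open>Keeps vertex 1 from being rewritten to \<open>Suc 0\<close>, so that facts about entries
  such as \<open>B 1 2\<close> still match.\<close>

declare One_nat_def [simp del]

section \<open>Skew-symmetry and mutation by signed path counts\<close>

definition skew :: "quiver \<Rightarrow> bool" where
  "skew B \<longleftrightarrow> (\<forall>i j. B i j = - B j i)"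

lemma skewD: "skew B \<Longrightarrow> B i j = - B j i"
  unfolding skew_def by blast

lemma skew_diag: "skew B \<Longrightarrow> B i i = 0"
  using skewD[of B i i] by simp

lemma quiver_on_skew: "quiver_on V B \<Longrightarrow> skew B"
  unfolding quiver_on_def skew_def by blast

lemma quiver_on_outside: "quiver_on V B \<Longrightarrow> i \<notin> V \<or> j \<notin> V \<Longrightarrow> B i j = 0"
  unfolding quiver_on_def by blast

(* For x = B i k and y = B k j: the number of paths i -> k -> j, minus that of paths j -> k -> i. *)
definition paths :: "int \<Rightarrow> int \<Rightarrow> int" where
  "paths x y = (if x > 0 \<and> y > 0 then x * y else if x < 0 \<and> y < 0 then - (x * y) else 0)"

lemma paths_minus: "paths (- x) (- y) = - paths x y"
  by (auto simp: paths_def)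

lemma paths_commute: "paths x y = paths y x"
  by (auto simp: paths_def)

lemma paths_zero [simp]: "paths 0 y = 0" "paths x 0 = 0"
  by (auto simp: paths_def)

lemma paths_pos: "x > 0 \<Longrightarrow> y > 0 \<Longrightarrow> paths x y = x * y"
  and paths_neg: "x < 0 \<Longrightarrow> y < 0 \<Longrightarrow> paths x y = - (x * y)"
  and paths_opposite: "x < 0 \<Longrightarrow> y > 0 \<Longrightarrow> paths x y = 0" "x > 0 \<Longrightarrow> y < 0 \<Longrightarrow> paths x y = 0"
  by (simp_all add: paths_def)

lemma abs_mult_div_2: "(\<bar>x\<bar> * y + x * \<bar>y\<bar>) div 2 = paths x y" for x y :: int
proof -
  have "\<bar>x\<bar> * y + x * \<bar>y\<bar> = 2 * paths x y"
    by (auto simp: paths_def abs_if)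
  then show ?thesis by simp
qed

lemma mutate_eq: "mutate k B i j = (if k = i \<or> k = j then - B i j else B i j + paths (B i k) (B k j))"
  by (simp add: mutate_def abs_mult_div_2)

text \<open>The first mutation negates both arguments of \<open>paths\<close>, so the second
  correction cancels the first.\<close>

lemma mutate_mutate: "mutate k (mutate k B) = B"
  by (intro ext) (simp add: mutate_eq paths_minus)

lemma skew_mutate:
  assumes "skew B" shows "skew (mutate k B)"
  unfolding skew_def
proof (intro allI)
  fix i j
  have "paths (B i k) (B k j) = - paths (B j k) (B k i)"
    using skewD[OF assms, of i k] skewD[OF assms, of k j]
    by (metis paths_minus paths_commute)
  then show "mutate k B i j = - mutate k B j i"
    using skewD[OF assms, of i j] by (auto simp: mutate_eq)
qed

lemma quiver_on_mutate:
  assumes "quiver_on V B" shows "quiver_on V (mutate k B)"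
  unfolding quiver_on_def
proof (intro conjI allI impI)
  show "finite V" using assms by (simp add: quiver_on_def)
  show "mutate k B i j = - mutate k B j i" for i j
    by (rule skewD[OF skew_mutate[OF quiver_on_skew[OF assms]]])
  show "mutate k B i j = 0" if "i \<notin> V \<or> j \<notin> V" for i j
  proof -
    have "B i k = 0 \<or> B k j = 0" and "B i j = 0"
      using quiver_on_outside[OF assms] that by blast+
    then show ?thesis by (auto simp: mutate_eq)
  qed
qed

section \<open>Mutation sequences and full subquivers\<close>

lemma mutate_seq_simps [simp]:
  "mutate_seq [] B = B"
  "mutate_seq (v # vs) B = mutate_seq vs (mutate v B)"
  "mutate_seq (us @ vs) B = mutate_seq vs (mutate_seq us B)"
  by (simp_all add: mutate_seq_def)

lemma skew_mutate_seq: "skew B \<Longrightarrow> skew (mutate_seq vs B)"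
  by (induction vs arbitrary: B) (simp_all add: skew_mutate)

lemma quiver_on_mutate_seq: "quiver_on V B \<Longrightarrow> quiver_on V (mutate_seq vs B)"
  by (induction vs arbitrary: B) (simp_all add: quiver_on_mutate)

text \<open>The correction at (i,j) reads only (i,k) and (k,j), which survive the restriction
  because k lies in S.\<close>

lemma full_subquiver_mutate:
  "k \<in> S \<Longrightarrow> full_subquiver S (mutate k B) = mutate k (full_subquiver S B)"
  by (intro ext) (auto simp: full_subquiver_def mutate_eq)

lemma full_subquiver_mutate_seq:
  "set vs \<subseteq> S \<Longrightarrow> full_subquiver S (mutate_seq vs B) = mutate_seq vs (full_subquiver S B)"
  by (induction vs arbitrary: B) (simp_all add: full_subquiver_mutate)

lemma mutate_seq_concat_replicate:
  "mutate_seq (concat (replicate m vs)) = mutate_seq vs ^^ m"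
  by (induction m) (simp_all add: fun_eq_iff funpow_swap1)

section \<open>Runs of sinks\<close>

text \<open>Closed form for mutating once at each vertex of S, every one a sink at its turn: an
  arrow inside S is reversed twice.\<close>

definition negate_at :: "nat set \<Rightarrow> quiver \<Rightarrow> quiver" where
  "negate_at S B = (\<lambda>i j. if (i \<in> S) \<noteq> (j \<in> S) then - B i j else B i j)"

lemma negate_at_insert:
  "v \<notin> S \<Longrightarrow> negate_at {v} (negate_at S B) = negate_at (insert v S) B"
  unfolding negate_at_def by (intro ext) (cases "v \<in> S"; force)

text \<open>No path passes through a sink, so only the sign change remains.\<close>

lemma mutate_sink:
  assumes "skew B" and "\<And>i. B i v \<ge> 0"
  shows "mutate v B = negate_at {v} B"
proof (intro ext)
  fix i j
  have "B v j \<le> 0" using assms(2)[of j] skewD[OF assms(1), of v j] by simp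
  then show "mutate v B i j = negate_at {v} B i j"
    using assms(2)[of i] skew_diag[OF assms(1), of v]
    by (auto simp: mutate_eq negate_at_def paths_def)
qed

text \<open>All hypotheses concern the initial quiver. When v has its turn, its arrows to larger
  vertices of the range have been reversed; their original signs come from the hypothesis at the
  larger vertex.\<close>

lemma mutate_seq_sinks:
  assumes "skew B" and "m \<le> n"
    and "\<And>i v. v \<in> {m..<n} \<Longrightarrow> i \<notin> {Suc v..<n} \<Longrightarrow> B i v \<ge> 0"
  shows "mutate_seq (rev [m..<n]) B = negate_at {m..<n} B"
  using assms(2,3)
proof (induction "n - m" arbitrary: m)
  case 0
  then show ?case by (simp add: negate_at_def)
next
  case (Suc d)
  let ?C = "negate_at {Suc m..<n} B"
  have "d = n - Suc m" "Suc m \<le> n" using Suc.hyps(2) by auto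
  then have IH: "mutate_seq (rev [Suc m..<n]) B = ?C"
    by (intro Suc.hyps(1)) (auto intro: Suc.prems(2))
  have sk: "skew ?C"
    unfolding skew_def negate_at_def using skewD[OF assms(1)] by (smt (verit))
  have "?C i m \<ge> 0" for i
  proof (cases "i \<in> {Suc m..<n}")
    case True
    then have "B m i \<ge> 0" by (intro Suc.prems(2)) auto
    then show ?thesis using True skewD[OF assms(1), of i m] by (simp add: negate_at_def)
  next
    case False
    then have "B i m \<ge> 0" using Suc.hyps(2) by (intro Suc.prems(2)) auto
    then show ?thesis using False by (auto simp: negate_at_def)
  qed
  then have "mutate m ?C = negate_at {m} ?C" by (rule mutate_sink[OF sk])
  also have "\<dots> = negate_at {m..<n} B"
  proof -
    have "insert m {Suc m..<n} = {m..<n}" using \<open>Suc m \<le> n\<close> by auto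
    then show ?thesis by (simp add: negate_at_insert)
  qed
  finally show "mutate_seq (rev [m..<n]) B = negate_at {m..<n} B"
    using IH \<open>Suc m \<le> n\<close> by (simp add: upt_conv_Cons)
qed

section \<open>Non-isolation along a sequence\<close>

text \<open>A recursive form that splits over \<open>@\<close>, so each segment of the cycle is
  checked from its own starting quiver.\<close>

fun nonisolated_along :: "nat set \<Rightarrow> quiver \<Rightarrow> nat list \<Rightarrow> bool" where
  "nonisolated_along V B [] \<longleftrightarrow> True"
| "nonisolated_along V B (v # vs) \<longleftrightarrow> \<not> isolated V B v \<and> nonisolated_along V (mutate v B) vs"

lemma nonisolated_along_append:
  "nonisolated_along V B (us @ vs) \<longleftrightarrow>
     nonisolated_along V B us \<and> nonisolated_along V (mutate_seq us B) vs"
  by (induction us arbitrary: B) auto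

lemma nonisolated_along_nth:
  "nonisolated_along V B vs \<Longrightarrow> t < length vs \<Longrightarrow>
     \<not> isolated V (mutate_seq (take t vs) B) (vs ! t)"
  by (induction vs arbitrary: B t) (auto simp: less_Suc_eq_0_disj)

text \<open>Mutating at 1 or 2 only flips the sign of (1,2), so these two vertices stay adjacent
  throughout.\<close>

lemma nonisolated_along_12:
  assumes "{1, 2} \<subseteq> V" "set vs \<subseteq> {1, 2}" "skew B" "B 1 2 \<noteq> 0"
  shows "nonisolated_along V B vs"
  using assms(2-4)
proof (induction vs arbitrary: B)
  case (Cons v vs)
  have "B 2 1 \<noteq> 0" using skewD[of B 2 1] Cons.prems by simp
  then have "\<not> isolated V B v"
    using Cons.prems assms(1) by (auto simp: isolated_def)
  moreover have "mutate v B 1 2 \<noteq> 0"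
    using Cons.prems by (auto simp: mutate_eq)
  ultimately show ?case
    using Cons skew_mutate by auto
qed simp

section \<open>Double mutations at 1 and 2\<close>

definition down :: "quiver \<Rightarrow> quiver" where "down B = mutate 1 (mutate 2 B)"

definition up :: "quiver \<Rightarrow> quiver" where "up B = mutate 2 (mutate 1 B)"

lemma up_down: "up (down B) = B"
  by (simp add: up_def down_def mutate_mutate)

lemma skew_down: "skew B \<Longrightarrow> skew (down B)"
  by (simp add: down_def skew_mutate)

lemma skew_up: "skew B \<Longrightarrow> skew (up B)"
  by (simp add: up_def skew_mutate)

lemma down_12 [simp]: "down B 1 2 = B 1 2"
  by (simp add: down_def mutate_eq)

lemma up_12 [simp]: "up B 1 2 = B 1 2"
  by (simp add: up_def mutate_eq)

lemma mutate_seq_21: "mutate_seq [2, 1] = down"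
  by (simp add: fun_eq_iff down_def)

lemma mutate_seq_12: "mutate_seq [1, 2] = up"
  by (simp add: fun_eq_iff up_def)

lemma skew_down_funpow: "skew B \<Longrightarrow> skew ((down ^^ m) B)"
  by (induction m) (simp_all add: skew_down)

lemma skew_up_funpow: "skew B \<Longrightarrow> skew ((up ^^ m) B)"
  by (induction m) (simp_all add: skew_up)

lemma down_funpow_12: "(down ^^ m) B 1 2 = B 1 2"
  by (induction m) simp_all

lemma up_funpow_12: "(up ^^ m) B 1 2 = B 1 2"
  by (induction m) simp_all

text \<open>\<open>B 1 j + paths (B 1 2) (B 2 j)\<close> is the entry (1,j) after the mutation at 2.
  No signs are assumed here; the later lemmas resolve each \<open>paths\<close> for one sign
  pattern.\<close>

lemma down_eq:
  assumes "skew B" "j \<notin> {1, 2}"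
  shows "down B 1 j = - (B 1 j + paths (B 1 2) (B 2 j))"
    and "down B 2 j = - B 2 j + paths (B 1 2) (B 1 j + paths (B 1 2) (B 2 j))"
    and "i \<notin> {1, 2} \<Longrightarrow> down B i j = B i j + paths (- B 2 i) (B 2 j) +
      paths (- (B 1 i + paths (B 1 2) (B 2 i))) (B 1 j + paths (B 1 2) (B 2 j))"
proof -
  let ?C = "mutate 2 B"
  have row: "?C 1 l = B 1 l + paths (B 1 2) (B 2 l)" if "l \<notin> {1, 2}" for l
    using that by (simp add: mutate_eq)
  have "?C 2 1 = B 1 2" "?C 2 j = - B 2 j"
    using skewD[OF assms(1), of 2 1] by (simp_all add: mutate_eq)
  then show "down B 1 j = - (B 1 j + paths (B 1 2) (B 2 j))"
    and "down B 2 j = - B 2 j + paths (B 1 2) (B 1 j + paths (B 1 2) (B 2 j))"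
    using assms(2) row[of j] by (simp_all add: down_def mutate_eq[of 1])
  assume i: "i \<notin> {1, 2}"
  have "?C i 1 = - (B 1 i + paths (B 1 2) (B 2 i))"
    using row[OF i] skewD[OF skew_mutate[OF assms(1)], of 2 i 1] by simp
  moreover have "?C i j = B i j + paths (- B 2 i) (B 2 j)"
    using i assms(2) skewD[OF assms(1), of i 2] by (simp add: mutate_eq)
  ultimately show "down B i j = B i j + paths (- B 2 i) (B 2 j) +
      paths (- (B 1 i + paths (B 1 2) (B 2 i))) (B 1 j + paths (B 1 2) (B 2 j))"
    using i assms(2) row[of j] by (simp add: down_def mutate_eq[of 1])
qed

lemma up_eq:
  assumes "skew B" "j \<notin> {1, 2}"
  shows "up B 1 j = - B 1 j + paths (- B 1 2) (B 2 j + paths (- B 1 2) (B 1 j))"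
    and "up B 2 j = - (B 2 j + paths (- B 1 2) (B 1 j))"
    and "i \<notin> {1, 2} \<Longrightarrow> up B i j = B i j + paths (- B 1 i) (B 1 j) +
      paths (- (B 2 i + paths (- B 1 2) (B 1 i))) (B 2 j + paths (- B 1 2) (B 1 j))"
proof -
  let ?C = "mutate 1 B"
  have row: "?C 2 l = B 2 l + paths (- B 1 2) (B 1 l)" if "l \<notin> {1, 2}" for l
    using that skewD[OF assms(1), of 2 1] by (simp add: mutate_eq)
  have "?C 1 2 = - B 1 2" "?C 1 j = - B 1 j"
    by (simp_all add: mutate_eq)
  then show "up B 1 j = - B 1 j + paths (- B 1 2) (B 2 j + paths (- B 1 2) (B 1 j))"
    and "up B 2 j = - (B 2 j + paths (- B 1 2) (B 1 j))"
    using assms(2) row[of j] by (simp_all add: up_def mutate_eq[of 2])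
  assume i: "i \<notin> {1, 2}"
  have "?C i 2 = - (B 2 i + paths (- B 1 2) (B 1 i))"
    using row[OF i] skewD[OF skew_mutate[OF assms(1)], of 1 i 2] by simp
  moreover have "?C i j = B i j + paths (- B 1 i) (B 1 j)"
    using i assms(2) skewD[OF assms(1), of i 1] by (simp add: mutate_eq)
  ultimately show "up B i j = B i j + paths (- B 1 i) (B 1 j) +
      paths (- (B 2 i + paths (- B 1 2) (B 1 i))) (B 2 j + paths (- B 1 2) (B 1 j))"
    using i assms(2) row[of j] by (simp add: up_def mutate_eq[of 2])
qed

section \<open>Double mutations under fixed sign patterns\<close>

lemma down_column:
  assumes "skew B" "B 1 2 > 0" "j \<notin> {1, 2}" "B 2 j > 0" "B 1 j + B 1 2 * B 2 j > 0"
  shows "down B 1 j = - (B 1 j + B 1 2 * B 2 j)"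
    and "down B 2 j = B 1 2 * (B 1 j + B 1 2 * B 2 j) - B 2 j"
  using assms by (simp_all add: down_eq paths_pos)

text \<open>Vertex 2 points to both i and j, and after mutation at 2 so does 1; hence no path joins
  i and j through either.\<close>

lemma down_entry:
  assumes "skew B" "B 1 2 > 0" "i \<notin> {1, 2}" "j \<notin> {1, 2}"
    and "B 2 i > 0" "B 1 i + B 1 2 * B 2 i > 0" "B 2 j > 0" "B 1 j + B 1 2 * B 2 j > 0"
  shows "down B i j = B i j"
  using assms by (simp add: down_eq paths_pos paths_opposite)

lemma up_column:
  assumes "skew B" "B 1 2 > 0" "j \<notin> {1, 2}" "B 1 j < 0" "B 2 j + B 1 2 * B 1 j < 0"
  shows "up B 1 j = - (B 1 2 * up B 2 j) - B 1 j"
    and "up B 2 j = - (B 2 j + B 1 2 * B 1 j)"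
  using assms by (simp_all add: up_eq paths_neg algebra_simps)

text \<open>Dual situation: i and j both point to 1 and, after mutation at 1, both point to
  2.\<close>

lemma up_entry:
  assumes "skew B" "B 1 2 > 0" "i \<notin> {1, 2}" "j \<notin> {1, 2}"
    and "B 1 i < 0" "B 2 i + B 1 2 * B 1 i < 0" "B 1 j < 0" "B 2 j + B 1 2 * B 1 j < 0"
  shows "up B i j = B i j"
  using assms by (simp add: up_eq paths_neg paths_opposite)

text \<open>The entry grows by the paths i -> 2 -> j and then i -> 1 -> j.\<close>

lemma down_entry_negative_positive:
  assumes "skew B" "B 1 2 > 0" "i \<notin> {1, 2}" "j \<notin> {1, 2}"
    and "B 1 i < 0" "B 2 i < 0" "B 2 j > 0" "B 1 j + B 1 2 * B 2 j > 0"
  shows "down B i j = B i j - B 2 i * B 2 j - B 1 i * (B 1 j + B 1 2 * B 2 j)"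
  using assms by (simp add: down_eq paths_pos paths_opposite)

text \<open>The entry drops by the paths j -> 2 -> i and then j -> 1 -> i.\<close>

lemma down_entry_positive_negative:
  assumes "skew B" "B 1 2 > 0" "i \<notin> {1, 2}" "j \<notin> {1, 2}"
    and "B 2 i > 0" "B 1 i + B 1 2 * B 2 i > 0" "B 1 j < 0" "B 2 j < 0"
  shows "down B i j = B i j + B 2 i * B 2 j + (B 1 i + B 1 2 * B 2 i) * B 1 j"
proof -
  have "paths (- (B 1 i + B 1 2 * B 2 i)) (B 1 j) = (B 1 i + B 1 2 * B 2 i) * B 1 j"
    using assms by (subst paths_neg) (simp_all add: algebra_simps)
  then show ?thesis
    using assms by (simp add: down_eq paths_pos paths_neg paths_opposite)
qed

text \<open>In the triangle on 1, 2, j, vertex 2 is a sink, and after its mutation so is 1.\<close>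

lemma down_column_negative:
  assumes "skew B" "B 1 2 > 0" "j \<notin> {1, 2}" "B 1 j < 0" "B 2 j < 0"
  shows "down B 1 j = - B 1 j" and "down B 2 j = - B 2 j"
  using assms by (simp_all add: down_eq paths_opposite)

section \<open>Growth of the linear recurrences\<close>

text \<open>The values \<open>C m 2 j\<close> and \<open>C m 1 j + B 1 2 * C m 2 j\<close>, taken
  alternately, satisfy x'' = a x' - x with a = \<open>B 1 2\<close>. Since a is at least 2, a
  positive nondecreasing start stays so; the middle inequality carries this through the
  induction.\<close>

lemma down_funpow_column:
  assumes "skew B" "B 1 2 \<ge> 2" "j \<notin> {1, 2}" "B 1 j > 0" "B 2 j > 0"
  defines "C m \<equiv> (down ^^ m) B"
  shows "C m 2 j > 0 \<and> C m 1 j + B 1 2 * C m 2 j \<ge> C m 2 j \<and> (m > 0 \<longrightarrow> C m 1 j < 0)"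
proof (induction m)
  case 0
  have "B 1 2 * B 2 j \<ge> 1 * B 2 j"
    using assms(2,5) by (intro mult_right_mono) auto
  moreover have "C 0 = B" by (simp add: C_def)
  ultimately show ?case
    unfolding \<open>C 0 = B\<close> using assms(4,5) by linarith
next
  case (Suc m)
  define w where "w = C m 1 j + B 1 2 * C m 2 j"
  have w: "w \<ge> C m 2 j" "C m 2 j > 0" using Suc by (auto simp: w_def)
  have step: "C (Suc m) 1 j = - w" "C (Suc m) 2 j = B 1 2 * w - C m 2 j"
    using down_column[of "C m" j] assms(2,3) w skew_down_funpow[OF assms(1), of m]
    by (simp_all add: C_def down_funpow_12 w_def)
  have "B 1 2 * w \<ge> 2 * w"
    using assms(2) w by (intro mult_right_mono) auto
  then have ge: "C (Suc m) 2 j \<ge> w" using step w by linarith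
  then have "B 1 2 * C (Suc m) 2 j \<ge> 2 * C (Suc m) 2 j"
    using assms(2) w by (intro mult_right_mono) auto
  then show ?case using ge step w by linarith
qed

text \<open>The same recurrence for \<open>C m 2 j\<close> and \<open>- C m 1 j\<close> in turn. It
  starts with a negative term followed by a positive one and is nondecreasing, so only the very
  first term is negative.\<close>

lemma up_funpow_column:
  assumes "skew B" "B 1 2 \<ge> 2" "j \<notin> {1, 2}" "B 1 j < 0" "B 2 j < 0"
  defines "C m \<equiv> (up ^^ m) B"
  shows up_funpow_column_sign:
      "C m 1 j < 0 \<and> C m 2 j + B 1 2 * C m 1 j \<le> C m 1 j \<and> (m > 0 \<longrightarrow> C m 2 j > 0)"
    and up_funpow_column_rec:
      "C (Suc m) 2 j = - (C m 2 j + B 1 2 * C m 1 j)"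
      "C (Suc m) 1 j = - B 1 2 * C (Suc m) 2 j - C m 1 j"
proof -
  \<comment> \<open>Recurrence and signs depend on each other: the recurrence is first proved
    conditionally, drives the induction on signs, and is then made unconditional.\<close>
  have step: "C (Suc m) 2 j = - (C m 2 j + B 1 2 * C m 1 j)"
      "C (Suc m) 1 j = - B 1 2 * C (Suc m) 2 j - C m 1 j"
    if "C m 1 j < 0" "C m 2 j + B 1 2 * C m 1 j \<le> C m 1 j" for m
    using up_column[of "C m" j] assms(2,3) that skew_up_funpow[OF assms(1), of m]
    by (simp_all add: C_def up_funpow_12)
  show sign: "C m 1 j < 0 \<and> C m 2 j + B 1 2 * C m 1 j \<le> C m 1 j \<and> (m > 0 \<longrightarrow> C m 2 j > 0)" for m
  proof (induction m)
    case 0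
    have "B 1 2 * B 1 j \<le> 1 * B 1 j"
      using assms(2,4) by (intro mult_right_mono_neg) auto
    moreover have "C 0 = B" by (simp add: C_def)
    ultimately show ?case
      unfolding \<open>C 0 = B\<close> using assms(4,5) by linarith
  next
    case (Suc m)
    note st = step[of m]
    have pos: "C (Suc m) 2 j \<ge> - C m 1 j" "C m 1 j < 0" using Suc st by auto
    have "B 1 2 * C (Suc m) 2 j \<ge> 2 * C (Suc m) 2 j"
      using assms(2) pos by (intro mult_right_mono) auto
    then have le: "C (Suc m) 1 j \<le> - C (Suc m) 2 j" using st Suc pos by auto
    then have "B 1 2 * C (Suc m) 1 j \<le> 2 * C (Suc m) 1 j"
      using assms(2) pos by (intro mult_right_mono_neg) auto
    then show ?case using le pos by linarith
  qed
  show "C (Suc m) 2 j = - (C m 2 j + B 1 2 * C m 1 j)"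
      "C (Suc m) 1 j = - B 1 2 * C (Suc m) 2 j - C m 1 j"
    using step[of m] sign[of m] by auto
qed

section \<open>Restricting the double mutations\<close>

lemma full_subquiver_down: "{1, 2} \<subseteq> S \<Longrightarrow> full_subquiver S (down B) = down (full_subquiver S B)"
  by (simp add: down_def full_subquiver_mutate)

lemma full_subquiver_up: "{1, 2} \<subseteq> S \<Longrightarrow> full_subquiver S (up B) = up (full_subquiver S B)"
  by (simp add: up_def full_subquiver_mutate)

lemma full_subquiver_down_funpow:
  "{1, 2} \<subseteq> S \<Longrightarrow> full_subquiver S ((down ^^ m) B) = (down ^^ m) (full_subquiver S B)"
  by (induction m) (simp_all add: full_subquiver_down)

lemma full_subquiver_up_funpow:
  "{1, 2} \<subseteq> S \<Longrightarrow> full_subquiver S ((up ^^ m) B) = (up ^^ m) (full_subquiver S B)"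
  by (induction m) (simp_all add: full_subquiver_up)

lemma up_funpow_down_funpow:
  "m \<le> k \<Longrightarrow> (up ^^ m) ((down ^^ k) B) = (down ^^ (k - m)) B"
proof (induction m)
  case (Suc m)
  then have "k - m = Suc (k - Suc m)" by simp
  with Suc show ?case by (simp add: up_down)
qed simp

lemma full_subquiver_entry:
  "full_subquiver S B = C \<Longrightarrow> i \<in> S \<Longrightarrow> j \<in> S \<Longrightarrow> B i j = C i j"
  by (auto simp: full_subquiver_def)

section \<open>Adjacency conditions for mutation cycles\<close>

lemma distinct_adj_alternating:
  assumes "x \<noteq> y" and "m > 0"
  shows "distinct_adj (concat (replicate m [x, y]))"
    and "hd (concat (replicate m [x, y])) = x"
    and "last (concat (replicate m [x, y])) = y"
proof -
  have "distinct_adj (concat (replicate (Suc l) [x, y])) \<and>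
      hd (concat (replicate (Suc l) [x, y])) = x \<and> last (concat (replicate (Suc l) [x, y])) = y" for l
    using assms(1) by (induction l) auto
  then show "distinct_adj (concat (replicate m [x, y]))"
    and "hd (concat (replicate m [x, y])) = x" and "last (concat (replicate m [x, y])) = y"
    using gr0_implies_Suc[OF assms(2)] by blast+
qed

lemma distinct_adj_cyclic:
  assumes "distinct_adj xs" "last xs \<noteq> hd xs" "t < length xs"
  shows "xs ! t \<noteq> xs ! (Suc t mod length xs)"
proof (cases "Suc t = length xs")
  case True
  then have "xs \<noteq> []" "t = length xs - 1" by auto
  then show ?thesis using True assms(2) by (simp add: last_conv_nth hd_conv_nth)
next
  case False
  then show ?thesis using assms(1,3) by (simp add: distinct_adj_nth)
qed

lemma mutation_cycleI:
  assumes "vs \<noteq> []" "length vs = N" "set vs \<subseteq> V" "distinct_adj vs" "last vs \<noteq> hd vs"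
    and "nonisolated_along V B vs" "mutate_seq vs B = B"
  shows "mutation_cycle V B N vs"
  using assms distinct_adj_cyclic[OF assms(4,5)] nonisolated_along_nth[OF assms(6)]
  by (simp add: mutation_cycle_def)

theorem theorem4p1:
  fixes n k :: nat and R Q :: quiver
  assumes "n \<ge> 4" and "k > 0"
    and "quiver_on {1..n-1} R"
    and "\<And>i j. i \<in> {1..n-1} \<Longrightarrow> j \<in> {1..n-1} \<Longrightarrow> i < j \<Longrightarrow> R i j \<ge> 2"
    and "quiver_on {1..n} Q"
    and "full_subquiver {1..n-1} Q = mutate_seq (concat (replicate k [2, 1])) R"
    and "\<And>i. i \<in> {1..n-1} \<Longrightarrow> Q i n \<ge> 2"
  shows "is_sink {1..n} Q n \<and>
    mutation_cycle {1..n} Q (n + 4 * k)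
      ([n] @ concat (replicate k [1, 2]) @ rev [1..<n] @ concat (replicate k [2, 1]))"
proof -
  define S where "S = {1..n-1}"
  define V where "V = {1..n}"
  define a where "a = R 1 2"
  define X where "X m = (down ^^ m) R" for m
  define Y where "Y m = (up ^^ m) (mutate n Q)" for m
  \<comment> \<open>The pair 2, 1 ending the descending run already undoes one \<open>up\<close>. So
    \<open>K\<close> = k - 1 further \<open>down\<close> steps reach the starting values, and one
    last pair remains.\<close>
  obtain K where K: "k = Suc K" using assms(2) by (cases k) auto
  have S12: "{1, 2} \<subseteq> S" "1 \<in> S" "2 \<in> S" and nS: "n \<notin> S" and n12: "n \<notin> {1, 2}"
    using assms(1) by (auto simp: S_def)
  have SV: "V = insert n S" "S \<subseteq> V"
    using assms(1) by (auto simp: S_def V_def)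
  have skR: "skew R" and skQ: "skew Q"
    using assms(3,5) by (auto intro: quiver_on_skew)
  have skX: "skew (X m)" and skY: "skew (Y m)" for m
    by (simp_all add: X_def Y_def skew_down_funpow skew_up_funpow skew_mutate skR skQ)
  have a2: "a \<ge> 2" unfolding a_def using assms(1) by (intro assms(4)) auto
  have R1: "R 1 j \<ge> 2" and R2: "R 2 j \<ge> 2" if "j \<in> {3..<n}" for j
    using that by (auto intro!: assms(4))
  have X12: "X m 1 2 = a" for m by (simp add: X_def a_def down_funpow_12)
  have Qsub: "full_subquiver S Q = X k"
    using assms(6) by (simp add: S_def X_def mutate_seq_concat_replicate mutate_seq_21)
  have Qn: "Q i n \<ge> 2" if "i \<in> S" for i using assms(7) that by (simp add: S_def)

  \<comment> \<open>Mutation at the sink n and the k steps \<open>up\<close>\<close>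
  \<comment> \<open>\<open>mutate_sink\<close> ranges over all naturals; outside \<open>V\<close>
    the entries are 0.\<close>
  have "Q i n \<ge> 0" for i
  proof (cases "i \<in> S")
    case False
    then have "i \<notin> V \<or> i = n" using SV by auto
    then show ?thesis
      using quiver_on_outside[OF assms(5)] skew_diag[OF skQ] by (auto simp: V_def)
  qed (use Qn[of i] in simp)
  then have mutQ: "mutate n Q = negate_at {n} Q" and sink: "is_sink V Q n"
    using mutate_sink[OF skQ] SV by (auto simp: is_sink_def)
  have Y12: "Y m 1 2 = a" for m
    using full_subquiver_entry[OF Qsub, of 1 2] S12 n12
    by (simp add: Y_def up_funpow_12 mutQ negate_at_def X12)

  have "full_subquiver S (mutate n Q) = X k"
    using nS by (intro ext) (auto simp: mutQ full_subquiver_def negate_at_def Qsub[symmetric])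
  then have Ysub: "full_subquiver S (Y m) = X (k - m)" if "m \<le> k" for m
    using that by (simp add: Y_def X_def full_subquiver_up_funpow[OF S12(1)] up_funpow_down_funpow)

  \<comment> \<open>Signs are chosen so that q 0, p 0, q 1, p 1, ... is one solution of the
    recurrence, positive except for q 0.\<close>
  define p where "p m = - Y m 1 n" for m
  define q where "q m = Y m 2 n" for m
  have Y0: "Y 0 1 n < 0" "Y 0 2 n < 0"
    using Qn[of 1] Qn[of 2] S12 n12 by (simp_all add: Y_def mutQ negate_at_def)
  have Y0a: "Y 0 1 2 \<ge> 2" using a2 Y12 by simp
  note col = up_funpow_column_sign[OF skY[of 0] Y0a n12 Y0]
    up_funpow_column_rec[OF skY[of 0] Y0a n12 Y0]
  have "(up ^^ m) (Y 0) = Y m" "up (Y m) = Y (Suc m)" for m by (simp_all add: Y_def)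
  then have p_pos: "p m > 0" and pq: "a * p m - q m \<ge> p m" and q_pos: "m > 0 \<Longrightarrow> q m > 0"
    and q_rec: "q (Suc m) = a * p m - q m" and p_rec: "p (Suc m) = a * q (Suc m) - p m" for m
    using col[of m] Y12 by (simp_all add: p_def q_def)
  have p0: "p 0 = Q 1 n" and q0: "q 0 = - Q 2 n"
    using n12 by (simp_all add: p_def q_def Y_def mutQ negate_at_def)

  have Xcol: "X m 2 j > 0" "X m 1 j + a * X m 2 j \<ge> X m 2 j" "m > 0 \<Longrightarrow> X m 1 j < 0"
    and Xrec: "X (Suc m) 1 j = - (X m 1 j + a * X m 2 j)"
      "X (Suc m) 2 j = a * (X m 1 j + a * X m 2 j) - X m 2 j"
    if j: "j \<in> {3..<n}" for m j
  proof -
    have j12: "j \<notin> {1, 2}" using j by auto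
    show c: "X m 2 j > 0" "X m 1 j + a * X m 2 j \<ge> X m 2 j" "m > 0 \<Longrightarrow> X m 1 j < 0"
      using down_funpow_column[OF skR _ j12, of m] a2 R1[OF j] R2[OF j]
      by (auto simp: X_def a_def)
    have "X (Suc m) = down (X m)" by (simp add: X_def)
    then show "X (Suc m) 1 j = - (X m 1 j + a * X m 2 j)"
      "X (Suc m) 2 j = a * (X m 1 j + a * X m 2 j) - X m 2 j"
      using down_column[OF skX _ j12, of m] X12 a2 c by auto
  qed

  have Ycol: "Y m j n = - Q j n" if "j \<in> {3..<n}" "m \<le> k" for j m
    using that(2)
  proof (induction m)
    case 0
    then show ?case using that(1) by (simp add: Y_def mutQ negate_at_def)
  next
    case (Suc m)
    \<comment> \<open>The step leaving \<open>Y m\<close> sees \<open>X\<close> at a positive index,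
      where the entries (1,j) are negative.\<close>
    have km: "k - m = Suc (k - Suc m)" using Suc.prems by simp
    have jS: "j \<in> S" "j \<notin> {1, 2}" using that(1) by (auto simp: S_def)
    have "Y m 1 j = X (k - m) 1 j" "Y m 2 j = X (k - m) 2 j"
      using Ysub[of m] Suc.prems jS S12 by (auto intro: full_subquiver_entry)
    moreover have "X (k - m) 1 j < 0" using Xcol(3)[OF that(1)] km by simp
    moreover have "X (k - m) 2 j + a * X (k - m) 1 j < 0"
      \<comment> \<open>By the recurrence the left side is
        \<open>- X (k - Suc m) 2 j\<close>.\<close>
      unfolding km Xrec[OF that(1)] using Xcol(1)[OF that(1), of "k - Suc m"]
      by (simp add: algebra_simps)
    ultimately have "up (Y m) j n = Y m j n"
      using up_entry[OF skY _ jS(2) n12, of m] Y12 a2 p_pos[of m] pq[of m]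
      by (simp add: p_def q_def)
    then show ?case using Suc by (simp add: Y_def)
  qed

  \<comment> \<open>The descending run n-1, ..., 1\<close>
  define F where "F = negate_at {3..<n} (Y k)"
  define Z where "Z m = (down ^^ m) (down F)" for m
  have Yk: "Y k i j = R i j" if "i \<in> S" "j \<in> S" for i j
    using full_subquiver_entry[OF Ysub[of k]] that by (simp add: X_def)
  have YV: "quiver_on V (mutate_seq vs Q)" for vs
    using quiver_on_mutate_seq assms(5) by (simp add: V_def)
  have seqY: "mutate_seq (concat (replicate m [1, 2])) (mutate n Q) = Y m" for m
    by (simp add: Y_def mutate_seq_concat_replicate mutate_seq_12)
  have Yout: "Y k i j = 0" if "i \<notin> V \<or> j \<notin> V" for i j
    using quiver_on_outside[OF YV[of "[n] @ concat (replicate k [1, 2])"]] that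
    by (simp add: seqY)
  \<comment> \<open>The run of sinks stops at 3 because 2 has \<open>q k\<close> > 0 arrows to n. A
    general m also supplies the intermediate quivers for the non-isolation check.\<close>
  have sinks: "mutate_seq (rev [m..<n]) (Y k) = negate_at {m..<n} (Y k)" if "m \<ge> 3" "m \<le> n" for m
  proof (rule mutate_seq_sinks[OF skY that(2)])
    fix i v assume v: "v \<in> {m..<n}" and i: "i \<notin> {Suc v..<n}"
    have v3: "v \<in> {3..<n}" "v \<in> S" using v that by (auto simp: S_def)
    have "i \<notin> V \<or> i = n \<or> i = v \<or> i \<in> S \<and> i < v"
      using i by (auto simp: S_def V_def)
    then consider "i \<notin> V" | "i = n" | "i = v" | "i \<in> S" "i < v" by blast
    then show "Y k i v \<ge> 0"
    proof cases
      case 1 then show ?thesis using Yout by simp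
    next
      case 2 then show ?thesis
        using Ycol[OF v3(1), of k] Qn[OF v3(2)] skewD[OF skY, of k n v] by simp
    next
      case 3 then show ?thesis using skew_diag[OF skY] by simp
    next
      case 4 then show ?thesis
        using Yk[of i v] v3 assms(4)[of i v] by (simp add: S_def)
    qed
  qed
  have "[1..<n] = 1 # 2 # [3..<n]"
    using assms(1) by (simp add: upt_conv_Cons numeral_eq_Suc One_nat_def)
  then have rev_upt: "rev [1..<n] = rev [3..<n] @ [2, 1]" by simp
  have seqF: "mutate_seq (rev [3..<n]) (Y k) = F" using sinks[of 3] assms(1) by (simp add: F_def)
  have seqZ0: "mutate_seq (rev [1..<n]) (Y k) = down F"
    by (simp add: rev_upt seqF down_def)
  have skF: "skew F" using skew_mutate_seq[OF skY] seqF by metis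
  have skZ: "skew (Z m)" for m by (simp add: Z_def skew_down_funpow skew_down skF)
  \<comment> \<open>With n deleted, 2 and 1 are sinks at their turns too. Every arrow is then
    reversed twice, so \<open>R\<close> returns.\<close>
  have "mutate_seq (rev [1..<n]) R = negate_at {1..<n} R"
  proof (rule mutate_seq_sinks[OF skR])
    fix i v assume v: "v \<in> {1..<n}" and i: "i \<notin> {Suc v..<n}"
    have "i \<notin> S \<or> i = v \<or> i \<in> S \<and> i < v"
      using i by (auto simp: S_def)
    then consider "i \<notin> S" | "i = v" | "i \<in> S" "i < v" by blast
    then show "R i v \<ge> 0"
    proof cases
      case 1 then show ?thesis using quiver_on_outside[OF assms(3)] by (simp add: S_def)
    next
      case 2 then show ?thesis using skew_diag[OF skR] by simp
    next
      case 3
      have "v \<in> {1..n-1}" using v by auto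
      then show ?thesis using 3 assms(4)[of i v] by (simp add: S_def)
    qed
  qed (use assms(1) in simp)
  also have "\<dots> = R"
  proof (intro ext)
    have "{1..n-1} = {1..<n}" using assms(1) by auto
    then show "negate_at {1..<n} R i j = R i j" for i j
      using quiver_on_outside[OF assms(3), of i j] by (auto simp: negate_at_def)
  qed
  finally have "full_subquiver S (down F) = R"
    using Ysub[of k] full_subquiver_mutate_seq[of "rev [1..<n]" S "Y k"]
    by (force simp: seqZ0 X_def S_def)
  then have Zsub: "full_subquiver S (Z m) = X m" for m
    by (simp add: Z_def X_def full_subquiver_down_funpow[OF S12(1)])
  have Z12: "Z m 1 2 = a" for m
    using full_subquiver_entry[OF Zsub] S12 X12 by simp

  \<comment> \<open>Column n under the backward recurrence\<close>
  have F12: "F 1 2 = a" and F1n: "F 1 n = - p k" and F2n: "F 2 n = q k"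
    using assms(1) Y12 by (simp_all add: F_def negate_at_def p_def q_def)
  have Fw: "F 1 n + a * F 2 n = p K"
    using p_rec[of K] by (simp add: F1n F2n K)
  have Z0_12n: "Z 0 1 n = - p K" "Z 0 2 n = q K"
    using down_column[OF skF _ n12] F12 a2 q_pos[of k] p_pos[of K] Fw F2n q_rec[of K]
    by (simp_all add: Z_def K)
  \<comment> \<open>The sinks turned the arrows so that j points to 1 and 2, and restored the sign
    of (j,n); the increase counts paths j -> 2 -> n and j -> 1 -> n.\<close>
  have Z0n: "Z 0 j n = Q j n + R 2 j * q k + R 1 j * p K" if j: "j \<in> {3..<n}" for j
  proof -
    have jS: "j \<in> S" "j \<notin> {1, 2}" using j by (auto simp: S_def)
    have "F 1 j = - R 1 j" "F 2 j = - R 2 j" "F j n = Q j n"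
      using j Yk[of _ j] jS S12 Ycol[OF j, of k] by (simp_all add: F_def negate_at_def)
    then show ?thesis
      using down_entry_negative_positive[OF skF _ jS(2) n12] F12 a2 R1[OF j] R2[OF j] Fw F2n
        q_pos[of k] p_pos[of K] K
      by (simp add: Z_def)
  qed
  have Zcol: "Z m 1 n = - p (K - m) \<and> Z m 2 n = q (K - m) \<and> (\<forall>j\<in>{3..<n}. Z m j n = Z 0 j n)"
    if "m \<le> K" for m
    using that
  proof (induction m)
    case 0
    then show ?case using Z0_12n by simp
  next
    case (Suc m)
    define l where "l = K - Suc m"
    have l: "K - m = Suc l" using Suc.prems by (simp add: l_def)
    have IH: "Z m 1 n = - p (Suc l)" "Z m 2 n = q (Suc l)"
      "\<And>j. j \<in> {3..<n} \<Longrightarrow> Z m j n = Z 0 j n"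
      using Suc l by auto
    have w: "Z m 1 n + a * Z m 2 n = p l" using p_rec[of l] IH by simp
    have Zs: "Z (Suc m) = down (Z m)" by (simp add: Z_def)
    have "Z (Suc m) 1 n = - p l" "Z (Suc m) 2 n = q l"
      using down_column[OF skZ _ n12, of m] Z12 a2 IH w q_pos[of "Suc l"] p_pos[of l] q_rec[of l]
      by (simp_all add: Zs)
    \<comment> \<open>Now 2 points to both j and n, and after its mutation so does 1: no path joins
      j and n.\<close>
    moreover have "Z (Suc m) j n = Z 0 j n" if j: "j \<in> {3..<n}" for j
    proof -
      have jS: "j \<in> S" "j \<notin> {1, 2}" using j by (auto simp: S_def)
      have "Z m 1 j = X m 1 j" "Z m 2 j = X m 2 j"
        using Zsub jS S12 by (auto intro: full_subquiver_entry)
      then have "down (Z m) j n = Z m j n"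
        using down_entry[OF skZ _ jS(2) n12, of m] Z12 a2 Xcol[OF j, of m] IH w
          q_pos[of "Suc l"] p_pos[of l] by simp
      then show ?thesis using IH(3)[OF j] Zs by simp
    qed
    ultimately show ?case by (simp add: l_def)
  qed
  (* The conserved pairing: (X m 1 j, X m 2 j) evolves contragrediently to (p, q). *)
  have inv: "X m 2 j * q (Suc (K - m)) + X m 1 j * p (K - m) = R 2 j * q k + R 1 j * p K"
    if j: "j \<in> {3..<n}" "m \<le> K" for j m
    using that(2)
  proof (induction m)
    case 0
    then show ?case by (simp add: X_def K)
  next
    case (Suc m)
    define l where "l = K - Suc m"
    have l: "K - m = Suc l" using Suc.prems by (simp add: l_def)
    have "X (Suc m) 2 j * q (Suc l) + X (Suc m) 1 j * p l
        = X m 2 j * q (Suc (Suc l)) + X m 1 j * p (Suc l)"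
      unfolding Xrec[OF j(1)] q_rec[of "Suc l"] p_rec[of l] by (simp add: algebra_simps)
    then show ?case using Suc l by (simp add: l_def)
  qed

  \<comment> \<open>The last pair and the return to Q\<close>
  have Zk: "Z k = down (Z K)" by (simp add: Z_def K)
  have ZK: "Z K 1 n = - Q 1 n" "Z K 2 n = - Q 2 n" using Zcol[of K] p0 q0 by simp_all
  have Zk12: "Z k 1 n = Q 1 n" "Z k 2 n = Q 2 n"
    using down_column_negative[OF skZ _ n12, of K] Z12 a2 ZK Qn[of 1] Qn[of 2] S12
    by (simp_all add: Zk)
  have Zkj: "Z k j n = Q j n" if j: "j \<in> {3..<n}" for j
  proof -
    have jS: "j \<in> S" "j \<notin> {1, 2}" using j by (auto simp: S_def)
    have ZX: "Z K 1 j = X K 1 j" "Z K 2 j = X K 2 j"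
      using Zsub jS S12 by (auto intro: full_subquiver_entry)
    have "Z k j n = Z K j n - X K 2 j * Q 2 n - (X K 1 j + a * X K 2 j) * Q 1 n"
      using down_entry_positive_negative[OF skZ _ jS(2) n12, of K] Z12 a2 Xcol[OF j, of K]
        ZK Qn[of 1] Qn[of 2] S12 by (simp add: Zk ZX)
    \<comment> \<open>The pairing at m = \<open>K\<close> rewrites the increase in terms of
      \<open>p 0\<close> and \<open>q 1\<close>; expanding \<open>q 1\<close> turns it into the
      decrease just found.\<close>
    also have "Z K j n = Q j n + (X K 2 j * q 1 + X K 1 j * p 0)"
      using Zcol[of K] Z0n[OF j] inv[OF j, of K] j by (simp add: One_nat_def)
    also have "q 1 = a * Q 1 n + Q 2 n"
      using q_rec[of 0] by (simp add: p0 q0 One_nat_def)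
    finally show ?thesis by (simp add: p0 algebra_simps)
  qed
  have Zkn: "Z k i n = Q i n" if "i \<in> S" for i
  proof -
    have "i = 1 \<or> i = 2 \<or> i \<in> {3..<n}" using that by (auto simp: S_def)
    then show ?thesis using Zk12 Zkj by auto
  qed
  let ?vs = "[n] @ concat (replicate k [1, 2]) @ rev [1..<n] @ concat (replicate k [2, 1])"
  have "mutate_seq (concat (replicate k [2, 1])) (down F) = Z k"
    by (simp add: Z_def mutate_seq_concat_replicate mutate_seq_21)
  then have seq: "mutate_seq ?vs Q = Z k"
    by (simp add: seqY seqZ0)
  have return: "mutate_seq ?vs Q = Q"
  proof (intro ext)
    fix i j
    consider "i \<in> S" "j \<in> S" | "i \<in> S" "j = n" | "i = n" "j \<in> S" | "i = n" "j = n"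
      | "i \<notin> V \<or> j \<notin> V"
      using SV by auto
    then have "Z k i j = Q i j"
    proof cases
      case 1 then show ?thesis
        using full_subquiver_entry[OF Zsub[of k]] full_subquiver_entry[OF Qsub] by simp
    next
      case 2 then show ?thesis using Zkn by simp
    next
      case 3 then show ?thesis
        using Zkn[of j] skewD[OF skZ, of k i j] skewD[OF skQ, of i j] by simp
    next
      case 4 then show ?thesis using skew_diag[OF skZ] skew_diag[OF skQ] by simp
    next
      case 5 then show ?thesis
        using quiver_on_outside[OF YV[of "?vs"]] quiver_on_outside[OF YV[of "[]"]]
        unfolding seq by auto
    qed
    then show "mutate_seq ?vs Q i j = Q i j" by (simp only: seq)
  qed

  \<comment> \<open>Non-isolation and distinct consecutive vertices\<close>
  have V12: "{1, 2} \<subseteq> V" using S12 SV by auto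
  have sets: "set (concat (replicate k [1, 2])) = {1, 2::nat}"
    "set (concat (replicate k [2, 1])) = {1, 2::nat}"
    using assms(2) by auto
  have "nonisolated_along V Q [n]"
    using Qn[of 1] S12 V12 skewD[OF skQ, of n 1] by (auto simp: isolated_def intro!: bexI[of _ 1])
  moreover have "nonisolated_along V (Y 0) (concat (replicate k [1, 2]))"
    using nonisolated_along_12[OF V12 _ skY] sets Y12 a2 by simp
  moreover have "nonisolated_along V (Y k) (rev [m..<n])" if "m \<ge> 3" "m \<le> n" for m
    using that
  proof (induction "n - m" arbitrary: m)
    case (Suc d)
    have m: "rev [m..<n] = rev [Suc m..<n] @ [m]" "m \<in> S" "Suc m \<le> n"
      using Suc.hyps(2) Suc.prems by (auto simp: upt_conv_Cons S_def)
    \<comment> \<open>Vertex 1 serves as neighbour: neither it nor m has been mutated yet in this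
      run.\<close>
    have "negate_at {Suc m..<n} (Y k) m 1 = - R 1 m"
      using Suc.prems Yk[OF m(2) S12(2)] skewD[OF skR, of m 1] by (simp add: negate_at_def)
    then have "negate_at {Suc m..<n} (Y k) m 1 \<noteq> 0"
      using R1[of m] m Suc.prems by simp
    then have "\<not> isolated V (negate_at {Suc m..<n} (Y k)) m"
      using V12 by (auto simp: isolated_def)
    moreover have "nonisolated_along V (Y k) (rev [Suc m..<n])"
      using Suc.hyps(2) Suc.prems m by (intro Suc.hyps(1)) auto
    ultimately show ?case
      using sinks[of "Suc m"] Suc.prems m by (simp add: nonisolated_along_append)
  qed simp
  then have "nonisolated_along V (Y k) (rev [3..<n])" using assms(1) by simp
  moreover have "nonisolated_along V F [2, 1]"
    using F12 a2 by (intro nonisolated_along_12[OF V12 _ skF]) auto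
  moreover have "nonisolated_along V (Z 0) (concat (replicate k [2, 1]))"
    using nonisolated_along_12[OF V12 _ skZ] sets Z12 a2 by simp
  moreover have "Y 0 = mutate n Q" "Z 0 = down F" by (simp_all add: Y_def Z_def)
  ultimately have noniso: "nonisolated_along V Q ?vs"
    unfolding rev_upt append_assoc nonisolated_along_append
    by (simp add: seqY seqF down_def)

  have ends: "hd (rev [1..<n]) = n - 1" "last (rev [1..<n]) = 1" "rev [1..<n] \<noteq> []"
    using assms(1) by (simp_all add: hd_rev last_rev last_upt)
  have nonempty: "concat (replicate k [1, 2]) \<noteq> []" "concat (replicate k [2, 1]) \<noteq> []"
    using sets by force+
  \<comment> \<open>At the junctions meet n and 1, 2 and n-1, 1 and 2; n >= 4 separates 2 from
    n-1.\<close>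
  have "distinct_adj [1..<n]" by (auto simp: distinct_adj_conv_nth)
  then have adj: "distinct_adj ?vs"
    unfolding distinct_adj_append_iff
    using ends nonempty distinct_adj_alternating[OF _ assms(2), of "1::nat" 2]
      distinct_adj_alternating[OF _ assms(2), of "2::nat" 1] assms(1)
    by simp
  have "last ?vs \<noteq> hd ?vs"
    using nonempty distinct_adj_alternating(3)[OF _ assms(2), of "2::nat" 1] assms(1) by simp
  moreover have "length ?vs = n + 4 * k"
    using assms(1) by (simp add: length_concat sum_list_replicate)
  moreover have "set ?vs \<subseteq> V"
    using sets assms(1) by (auto simp: V_def)
  ultimately have "mutation_cycle V Q (n + 4 * k) ?vs"
    by (intro mutation_cycleI adj noniso return) simp_all
  then show ?thesis using sink by (simp only: V_def)
qed

end
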